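(* Let $\Lambda$ be a non-atomic Radon probability measure on $[0,1]$ with full topological support, let $\mathscr{U}(x):=\Lambda([0,x])$, and let $\mathcal{F}$ be the set of continuous functions $f:[0,1]\to\mathbb{R}$ such that $f\circ\mathscr{U}^{-1}$ is absolutely continuous and $\nabla(f\circ\mathscr{U}^{-1})\in L^2(\mathrm{d}x)$. Let $$\delta_*:=\sup\{\alpha\in(0,1] : \text{there exists a non-constant } \alpha\text{-Hölder continuous } f\in\mathcal{F}\},$$ with $\delta_*=0$ if this set is empty. Then $\delta_*=\overline{\dim}_{\mathrm{H}}\,\Lambda$.
   Context: $\mathrm{d}x$ is the Lebesgue measure on $[0,1]$ and $\nabla h$ is the weak derivative of an absolutely continuous $h:[0,1]\to\mathbb{R}$. Since $\Lambda$ is non-atomic with full topological support (positive on non-empty relatively open subsets of $[0,1]$), $\mathscr{U}:[0,1]\to[0,1]$ is an increasing homeomorphism. The set $\mathcal{F}$ is the domain of the Dirichlet form $\mathcal{E}(f,g):=\int_0^1\nabla(f\circ\mathscr{U}^{-1})\cdot\nabla(g\circ\mathscr{U}^{-1})\,\mathrm{d}x$, and $\delta_*$ is called its critical Hölder exponent. A function $f:[0,1]\to\mathbb{R}$ is $\alpha$-Hölder continuous if there is $K>0$ with $|f(x)-f(y)|\le K|x-y|^\alpha$ for all $x,y\in[0,1]$. Balls are $B(x,r):=\{y\in[0,1]:|x-y|<r\}$. For a Radon measure $\nu$ on $[0,1]$, the lower pointwise dimension at $x$ is $\underline{\dim}_{\mathrm{loc}}(\nu,x):=\liminf_{r\downarrow0}\frac{\log\nu(B(x,r))}{\log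 r}$, and the upper Hausdorff dimension $\overline{\dim}_{\mathrm{H}}\,\nu$ is the $\nu$-essential supremum of $x\mapsto\underline{\dim}_{\mathrm{loc}}(\nu,x)$. *)

theory Defs
  imports "HOL-Probability.Probability"
begin

text \<open>
  Functions on \<open>[0,1]\<close> are total functions \<open>real \<Rightarrow> real\<close> of which only the values on \<open>{0..1}\<close>
  matter. Measures on \<open>[0,1]\<close> are measures whose \<open>\<sigma>\<close>-algebra is that of
  \<open>restrict_space borel {0..1}\<close>, so that their space is \<open>{0..1}\<close>.
\<close>

definition absolutely_continuous_on :: "real set \<Rightarrow> (real \<Rightarrow> real) \<Rightarrow> bool" where
  "absolutely_continuous_on S f \<longleftrightarrow>
     (\<forall>e>0. \<exists>d>0. \<forall>I :: (real \<times> real) set.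
        finite I \<longrightarrow>
        (\<forall>(a, b)\<in>I. a < b \<and> {a..b} \<subseteq> S) \<longrightarrow>
        disjoint_family_on (\<lambda>(a, b). {a<..<b}) I \<longrightarrow>
        (\<Sum>(a, b)\<in>I. b - a) < d \<longrightarrow>
        (\<Sum>(a, b)\<in>I. \<bar>f b - f a\<bar>) < e)"

definition locally_integrable_on :: "(real \<Rightarrow> real) \<Rightarrow> real set \<Rightarrow> bool" where
  "locally_integrable_on f S \<longleftrightarrow>
     (\<forall>K. compact K \<longrightarrow> K \<subseteq> S \<longrightarrow> f absolutely_integrable_on K)"

text \<open>The space \<open>C\<^sub>c\<^sup>\<infinity>(S)\<close> for open \<open>S\<close>, each function being extended by zero to \<open>UNIV\<close>.\<close>

definition test_functions :: "real set \<Rightarrow> (real \<Rightarrow> real) set" where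
  "test_functions S =
     {\<phi>. (\<forall>n x. (deriv ^^ n) \<phi> differentiable at x) \<and>
         compact (closure {x. \<phi> x \<noteq> 0}) \<and> closure {x. \<phi> x \<noteq> 0} \<subseteq> S}"

definition has_weak_derivative_on ::
  "(real \<Rightarrow> real) \<Rightarrow> (real \<Rightarrow> real) \<Rightarrow> real set \<Rightarrow> bool" where
  "has_weak_derivative_on h g S \<longleftrightarrow>
     locally_integrable_on h S \<and> locally_integrable_on g S \<and>
     (\<forall>\<phi>\<in>test_functions S.
        (LINT x:S|lebesgue. h x * deriv \<phi> x) = - (LINT x:S|lebesgue. g x * \<phi> x))"

definition square_integrable_on :: "(real \<Rightarrow> real) \<Rightarrow> real set \<Rightarrow> bool" where
  "square_integrable_on g S \<longleftrightarrow>
     g \<in> borel_measurable (lebesgue_on S) \<and> integrable (lebesgue_on S) (\<lambda>x. (g x)\<^sup>2)"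

text \<open>
  Every finite Borel measure on the compact metric space \<open>[0,1]\<close> is Radon, so no regularity
  condition has to be imposed.
\<close>

definition radon_prob_unit_interval :: "real measure \<Rightarrow> bool" where
  "radon_prob_unit_interval \<Lambda> \<longleftrightarrow>
     prob_space \<Lambda> \<and> sets \<Lambda> = sets (restrict_space borel {0..1})"

definition non_atomic :: "real measure \<Rightarrow> bool" where
  "non_atomic \<Lambda> \<longleftrightarrow> (\<forall>x\<in>{0..1}. measure \<Lambda> {x} = 0)"

definition full_support :: "real measure \<Rightarrow> bool" where
  "full_support \<Lambda> \<longleftrightarrow>
     (\<forall>V. openin (top_of_set {0..1}) V \<longrightarrow> V \<noteq> {} \<longrightarrow> measure \<Lambda> V > 0)"

definition dist_fun :: "real measure \<Rightarrow> real \<Rightarrow> real" where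
  "dist_fun \<Lambda> x = measure \<Lambda> {0..x}"

definition dirichlet_domain :: "real measure \<Rightarrow> (real \<Rightarrow> real) set" where
  "dirichlet_domain \<Lambda> =
     {f. continuous_on {0..1} f \<and>
         (let h = f \<circ> inv_into {0..1} (dist_fun \<Lambda>) in
            absolutely_continuous_on {0..1} h \<and>
            (\<exists>g. has_weak_derivative_on h g {0<..<1} \<and> square_integrable_on g {0..1}))}"

definition holder_on :: "real \<Rightarrow> real set \<Rightarrow> (real \<Rightarrow> real) \<Rightarrow> bool" where
  "holder_on \<alpha> S f \<longleftrightarrow>
     (\<exists>K>0. \<forall>x\<in>S. \<forall>y\<in>S. \<bar>f x - f y\<bar> \<le> K * \<bar>x - y\<bar> powr \<alpha>)"

definition critical_holder_exponent :: "real measure \<Rightarrow> real" where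
  "critical_holder_exponent \<Lambda> =
     (let A = {\<alpha>. 0 < \<alpha> \<and> \<alpha> \<le> 1 \<and>
               (\<exists>f\<in>dirichlet_domain \<Lambda>. \<not> f constant_on {0..1} \<and> holder_on \<alpha> {0..1} f)}
      in if A = {} then 0 else Sup A)"

text \<open>
  The case distinction implements \<open>log 0 = -\<infinity>\<close> (whereas \<open>ln 0 = 0\<close>); as \<open>log r < 0\<close> for small
  \<open>r\<close>, the quotient is then \<open>\<infinity>\<close>.
\<close>

definition lower_local_dim :: "real measure \<Rightarrow> real \<Rightarrow> ereal" where
  "lower_local_dim \<nu> x =
     Liminf (at_right 0) (\<lambda>r.
       let m = measure \<nu> {y\<in>{0..1}. \<bar>x - y\<bar> < r}
       in if m = 0 then \<infinity> else ereal (ln m / ln r))"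

definition upper_hausdorff_dim :: "real measure \<Rightarrow> ereal" where
  "upper_hausdorff_dim \<nu> = esssup \<nu> (lower_local_dim \<nu>)"

end

theory Submission
  imports Defs
begin

text \<open>
  Write \<open>U\<close> for the distribution function of \<open>\<Lambda>\<close> and \<open>V\<close> for its inverse. The homeomorphism \<open>U\<close>
  carries \<open>\<Lambda>\<close> to Lebesgue measure (\<open>emeasure_image_U\<close>), so a function \<open>f\<close> in the Dirichlet domain is
  an absolutely continuous function \<open>h = f \<circ> V\<close> seen through this change of variables, and
  \<open>f y - f x\<close> compares with \<open>U y - U x = \<Lambda> {x..y}\<close> wherever \<open>h\<close> has a non-zero derivative. This is
  how a Hoelder bound on \<open>f\<close> and a power bound on the \<open>\<Lambda>\<close>-mass of small balls are exchanged.

  \<^emph>\<open>Exponents are at most the dimension.\<close> Let \<open>f\<close> be non-constant and \<open>\<alpha>\<close>-Hoelder. Call a point \<open>u\<close>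
  expanding if \<open>\<bar>h v - h u\<bar> \<ge> c * \<bar>v - u\<bar>\<close> for some \<open>c > 0\<close> and all \<open>v\<close> near \<open>u\<close>. At the point \<open>x = V u\<close>
  the two bounds on \<open>\<bar>f y - f x\<bar>\<close> give \<open>c * \<bar>U y - U x\<bar> \<le> K * \<bar>y - x\<bar> powr \<alpha>\<close>, so balls around \<open>x\<close> have
  mass at most a constant times \<open>r powr \<alpha>\<close>, and the lower local dimension at \<open>x\<close> is at least \<open>\<alpha>\<close>
  (\<open>lower_local_dim_ge_at_expanding_point\<close>). The expanding points cannot form a Lebesgue null set:
  otherwise the intervals on which \<open>h\<close> has arbitrarily small slope form a Vitali cover of almost
  every point, and absolute continuity forces \<open>h\<close> to be constant
  (\<open>absolutely_continuous_nonexpanding_imp_eq\<close>).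

  \<^emph>\<open>All smaller exponents occur.\<close> If \<open>0 < \<alpha>\<close> is less than the dimension, then for some \<open>R\<close> the set
  \<open>E\<close> of all \<open>x\<close> whose balls of radius \<open>r < R\<close> have mass at most \<open>r powr \<alpha>\<close> has positive measure. The
  function \<open>f x = \<Lambda> (E \<inter> {0..x})\<close> is then not constant. It is \<open>\<alpha>\<close>-Hoelder, because a
  short interval in which \<open>f\<close> grows meets \<open>E\<close> and so lies in a ball centred in \<open>E\<close>
  (\<open>restricted_dist_fun_holder\<close>). It lies in the Dirichlet domain, because \<open>f \<circ> V\<close> is the
  Lebesgue measure of \<open>U ` E \<inter> {0..u}\<close> as a function of \<open>u\<close>, with the indicator of \<open>U ` E\<close> as
  weak derivative (\<open>restricted_dist_fun_in_dirichlet_domain\<close>). As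
  Hoelder functions with exponent above one are constant, such an \<open>\<alpha>\<close> is at most one and therefore
  admissible in the supremum; in particular the dimension is at most one.

  The sets \<open>E\<close> are closed, and countably many of them describe each superlevel set of the lower
  local dimension. This gives the measurability on which the essential supremum depends.
\<close>

section \<open>Absolutely continuous functions that nowhere expand\<close>

lemma absolutely_continuous_on_subset:
  assumes "absolutely_continuous_on S f" "T \<subseteq> S"
  shows "absolutely_continuous_on T f"
  unfolding absolutely_continuous_on_def
proof (intro allI impI)
  fix e :: real assume "e > 0"
  then obtain d where "d > 0" and d: "\<And>I. finite I \<Longrightarrow> \<forall>(a, b)\<in>I. a < b \<and> {a..b} \<subseteq> S \<Longrightarrow>
        disjoint_family_on (\<lambda>(a, b). {a<..<b}) I \<Longrightarrow> (\<Sum>(a, b)\<in>I. b - a) < d \<Longrightarrow>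
        (\<Sum>(a, b)\<in>I. \<bar>f b - f a\<bar>) < e"
    using assms(1) unfolding absolutely_continuous_on_def by blast
  show "\<exists>d>0. \<forall>I. finite I \<longrightarrow> (\<forall>(a, b)\<in>I. a < b \<and> {a..b} \<subseteq> T) \<longrightarrow>
        disjoint_family_on (\<lambda>(a, b). {a<..<b}) I \<longrightarrow> (\<Sum>(a, b)\<in>I. b - a) < d \<longrightarrow>
        (\<Sum>(a, b)\<in>I. \<bar>f b - f a\<bar>) < e"
  proof (intro exI conjI allI impI)
    show "d > 0" by fact
  next
    fix I :: "(real \<times> real) set"
    assume I: "finite I" "\<forall>(a, b)\<in>I. a < b \<and> {a..b} \<subseteq> T"
      "disjoint_family_on (\<lambda>(a, b). {a<..<b}) I" "(\<Sum>(a, b)\<in>I. b - a) < d"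
    have "\<forall>(a, b)\<in>I. a < b \<and> {a..b} \<subseteq> S"
      using I(2) assms(2) by fast
    then show "(\<Sum>(a, b)\<in>I. \<bar>f b - f a\<bar>) < e" using d I by blast
  qed
qed

lemma lipschitz_imp_absolutely_continuous_on:
  assumes "\<And>a b. a \<in> S \<Longrightarrow> b \<in> S \<Longrightarrow> \<bar>h b - h a\<bar> \<le> \<bar>b - a\<bar>"
  shows "absolutely_continuous_on S h"
  unfolding absolutely_continuous_on_def
proof (intro allI impI)
  fix e :: real assume "e > 0"
  show "\<exists>d>0. \<forall>I. finite I \<longrightarrow> (\<forall>(a, b)\<in>I. a < b \<and> {a..b} \<subseteq> S) \<longrightarrow>
        disjoint_family_on (\<lambda>(a, b). {a<..<b}) I \<longrightarrow> (\<Sum>(a, b)\<in>I. b - a) < d \<longrightarrow>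
        (\<Sum>(a, b)\<in>I. \<bar>h b - h a\<bar>) < e"
  proof (intro exI conjI allI impI)
    show "e > 0" by fact
  next
    fix I :: "(real \<times> real) set"
    assume I: "\<forall>(a, b)\<in>I. a < b \<and> {a..b} \<subseteq> S" "(\<Sum>(a, b)\<in>I. b - a) < e"
    have "(\<Sum>(a, b)\<in>I. \<bar>h b - h a\<bar>) \<le> (\<Sum>(a, b)\<in>I. b - a)"
    proof (rule sum_mono)
      fix i assume "i \<in> I"
      then obtain a b where i: "i = (a, b)" "a < b" "{a..b} \<subseteq> S" using I(1) by (cases i) auto
      then have "a \<in> S" "b \<in> S" by auto
      from assms[OF this] i show "(case i of (a, b) \<Rightarrow> \<bar>h b - h a\<bar>) \<le> (case i of (a, b) \<Rightarrow> b - a)"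
        by simp
    qed
    then show "(\<Sum>(a, b)\<in>I. \<bar>h b - h a\<bar>) < e" using I(2) by simp
  qed
qed

text \<open>
  The difference quotients of \<open>h\<close> at \<open>u\<close> stay away from zero. A non-zero derivative implies this,
  but the property makes sense without differentiability, and its negation says exactly that
  arbitrarily short intervals ending at \<open>u\<close> have arbitrarily small slope.
\<close>

definition expanding_at :: "(real \<Rightarrow> real) \<Rightarrow> real \<Rightarrow> bool" where
  "expanding_at h u \<longleftrightarrow> (\<exists>c>0. \<forall>\<^sub>F v in nhds u. c * \<bar>v - u\<bar> \<le> \<bar>h v - h u\<bar>)"

text \<open>
  The gaps that finitely many disjoint closed intervals leave in \<open>{p..q}\<close>, together with the
  triangle inequality along the resulting partition. The induction adds the intervals in the order
  of their right end points, so that only the gap to the right of the newest one has to be added.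
\<close>

lemma complementary_intervals:
  fixes h :: "real \<Rightarrow> real"
  assumes "finite F" "p \<le> q"
    and "\<And>u v. (u, v) \<in> F \<Longrightarrow> p \<le> u \<and> u < v \<and> v \<le> q"
    and "pairwise (\<lambda>i j. disjnt {fst i..snd i} {fst j..snd j}) F"
  shows "\<exists>I. finite I \<and> (\<forall>(a, b)\<in>I. a < b \<and> {a..b} \<subseteq> {p..q}) \<and>
           disjoint_family_on (\<lambda>(a, b). {a<..<b}) I \<and>
           (\<Sum>(a, b)\<in>I. b - a) = (q - p) - (\<Sum>(u, v)\<in>F. v - u) \<and>
           \<bar>h q - h p\<bar> \<le> (\<Sum>(u, v)\<in>F. \<bar>h v - h u\<bar>) + (\<Sum>(a, b)\<in>I. \<bar>h b - h a\<bar>)"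
  using assms
proof (induction F arbitrary: q rule: finite_ranking_induct[where f = snd])
  case empty
  show ?case
  proof (cases "p = q")
    case True
    then show ?thesis by (intro exI[of _ "{}"]) (simp add: disjoint_family_on_def)
  next
    case False
    then show ?thesis using empty
      by (intro exI[of _ "{(p, q)}"]) (simp add: disjoint_family_on_def)
  qed
next
  case (insert x F q)
  show ?case
  proof (cases "x \<in> F")
    case True
    then show ?thesis using insert by (simp add: insert_absorb)
  next
    case False
    obtain u v where x: "x = (u, v)" by fastforce
    have uv: "p \<le> u" "u < v" "v \<le> q" using insert.prems x by auto
    have left: "b < u" if "(a, b) \<in> F" for a b
    proof -
      have "a < b" "b \<le> v" using insert that x by auto
      moreover have "disjnt {a..b} {u..v}"
        using insert.prems(3) that False x by (auto simp: pairwise_def)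
      ultimately show ?thesis
        by (auto simp: disjnt_iff dest!: spec[of _ b])
    qed
    have "\<exists>I. finite I \<and> (\<forall>(a, b)\<in>I. a < b \<and> {a..b} \<subseteq> {p..u}) \<and>
           disjoint_family_on (\<lambda>(a, b). {a<..<b}) I \<and>
           (\<Sum>(a, b)\<in>I. b - a) = (u - p) - (\<Sum>(u, v)\<in>F. v - u) \<and>
           \<bar>h u - h p\<bar> \<le> (\<Sum>(u, v)\<in>F. \<bar>h v - h u\<bar>) + (\<Sum>(a, b)\<in>I. \<bar>h b - h a\<bar>)"
    proof (rule insert.IH)
      show "p \<le> a \<and> a < b \<and> b \<le> u" if "(a, b) \<in> F" for a b
        using insert.prems(2)[of a b] left[OF that] that by auto
      show "pairwise (\<lambda>i j. disjnt {fst i..snd i} {fst j..snd j}) F"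
        using insert.prems(3) by (simp add: pairwise_insert)
    qed (use uv in auto)
    then obtain I where I: "finite I" "\<And>a b. (a, b)\<in>I \<Longrightarrow> a < b \<and> {a..b} \<subseteq> {p..u}"
           "disjoint_family_on (\<lambda>(a, b). {a<..<b}) I"
           "(\<Sum>(a, b)\<in>I. b - a) = (u - p) - (\<Sum>(u, v)\<in>F. v - u)"
           "\<bar>h u - h p\<bar> \<le> (\<Sum>(u, v)\<in>F. \<bar>h v - h u\<bar>) + (\<Sum>(a, b)\<in>I. \<bar>h b - h a\<bar>)"
      by fast
    have sF: "(\<Sum>(u, v)\<in>insert x F. k u v) = k u v + (\<Sum>(u, v)\<in>F. k u v)" for k :: "real \<Rightarrow> real \<Rightarrow> real"
      using insert.hyps False x by simp
    have Ile: "b \<le> u" if "(a, b) \<in> I" for a b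
      using I(2)[OF that] by auto
    show ?thesis
    proof (cases "v = q")
      case True
      show ?thesis
        by (rule exI[of _ I]) (use I uv in \<open>fastforce simp: sF True\<close>)
    next
      case False
      then have vq: "v < q" using uv by simp
      have notin: "(v, q) \<notin> I" using Ile[of v q] uv vq by auto
      have sI: "(\<Sum>(u, v)\<in>insert (v, q) I. k u v) = k v q + (\<Sum>(u, v)\<in>I. k u v)"
        for k :: "real \<Rightarrow> real \<Rightarrow> real"
        using I(1) notin by simp
      have "disjoint_family_on (\<lambda>(a, b). {a<..<b}) (insert (v, q) I)"
        using I(3) Ile uv notin
        by (subst disjoint_family_on_insert) (fastforce)+
      moreover have "\<forall>(a, b)\<in>insert (v, q) I. a < b \<and> {a..b} \<subseteq> {p..q}"
        using I(2) uv vq by fastforce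
      ultimately show ?thesis
        using I uv by (intro exI[of _ "insert (v, q) I"]) (auto simp: sF sI)
    qed
  qed
qed

text \<open>
  This generalizes the theorem that an absolutely continuous function with derivative zero almost
  everywhere is constant, and so does the proof. For \<open>e > 0\<close> the intervals of slope at most \<open>e\<close> are a
  Vitali cover of almost all of \<open>{p<..<q}\<close>. Finitely many disjoint ones fill \<open>{p..q}\<close> up to a set
  of small measure; over them \<open>h\<close> varies by at most \<open>e * (q - p)\<close>, and over the remaining gaps by at
  most \<open>e\<close> because of absolute continuity.
\<close>

lemma absolutely_continuous_nonexpanding_imp_eq:
  fixes h :: "real \<Rightarrow> real"
  assumes ac: "absolutely_continuous_on {p..q} h" and pq: "p \<le> q"
    and neg: "negligible {u\<in>{p<..<q}. expanding_at h u}"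
  shows "h p = h q"
proof -
  have "\<bar>h q - h p\<bar> \<le> e * (q - p) + e" if e: "e > 0" for e
  proof -
    obtain d where "d > 0" and d: "\<And>I. finite I \<Longrightarrow> \<forall>(a, b)\<in>I. a < b \<and> {a..b} \<subseteq> {p..q} \<Longrightarrow>
        disjoint_family_on (\<lambda>(a, b). {a<..<b}) I \<Longrightarrow> (\<Sum>(a, b)\<in>I. b - a) < d \<Longrightarrow>
        (\<Sum>(a, b)\<in>I. \<bar>h b - h a\<bar>) < e"
      using ac e unfolding absolutely_continuous_on_def by blast
    define K where "K = {(u, v). p \<le> u \<and> u < v \<and> v \<le> q \<and> \<bar>h v - h u\<bar> \<le> e * (v - u)}"
    define S where "S = {u\<in>{p<..<q}. \<not> expanding_at h u}"
    \<comment> \<open>Vitali's theorem speaks of balls, so intervals are given by midpoint and radius.\<close>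
    define a where "a = (\<lambda>(u :: real, v :: real). (u + v) / 2)"
    define r where "r = (\<lambda>(u :: real, v :: real). (v - u) / 2)"
    have cball: "cball (a i) (r i) = {fst i..snd i}" for i
      by (cases i) (auto simp: a_def r_def cball_eq_atLeastAtMost field_simps)
    obtain C where C: "countable C" "C \<subseteq> K"
      "pairwise (\<lambda>i j. disjnt (cball (a i) (r i)) (cball (a j) (r j))) C"
      "negligible (S - (\<Union>i \<in> C. cball (a i) (r i)))"
    proof (rule Vitali_covering_theorem_cballs[of K r S a])
      show "0 < r i" if "i \<in> K" for i using that by (auto simp: K_def r_def)
    next
      fix x \<delta> :: real assume x: "x \<in> S" and "0 < \<delta>"
      have "\<exists>\<^sub>F v in nhds x. \<bar>h v - h x\<bar> < e * \<bar>v - x\<bar>"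
        using x e by (auto simp: S_def expanding_at_def frequently_def not_less dest!: spec[of _ e])
      moreover have "\<forall>\<^sub>F v in nhds x. v \<in> {p<..<q}"
        using x by (intro eventually_nhds_in_open) (auto simp: S_def)
      moreover have "\<forall>\<^sub>F v in nhds x. dist v x < \<delta>"
        using \<open>0 < \<delta>\<close> by (auto simp: eventually_nhds_metric)
      ultimately have "\<exists>\<^sub>F v in nhds x. \<bar>h v - h x\<bar> < e * \<bar>v - x\<bar> \<and> v \<in> {p<..<q} \<and> dist v x < \<delta>"
        by (intro frequently_eventually_frequently eventually_conj)
      then obtain v where v: "\<bar>h v - h x\<bar> < e * \<bar>v - x\<bar>" "v \<in> {p<..<q}" "\<bar>v - x\<bar> < \<delta>"
        by (auto dest!: frequently_ex simp: dist_real_def)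
      have x': "x \<in> {p<..<q}" using x by (simp add: S_def)
      have "v \<noteq> x" using v(1) by auto
      \<comment> \<open>The point covered is an end point of the interval, on the side that \<open>v\<close> determines.\<close>
      show "\<exists>i. i \<in> K \<and> x \<in> cball (a i) (r i) \<and> r i < \<delta>"
        unfolding cball using v x' \<open>v \<noteq> x\<close> \<open>0 < \<delta>\<close>
        by (intro exI[of _ "(min x v, max x v)"])
           (auto simp: K_def r_def min_def max_def abs_minus_commute)
    qed auto
    have fm: "{fst i..snd i} \<in> lmeasurable" for i :: "real \<times> real" by auto
    define \<D> where "\<D> = (\<lambda>i. {fst i..snd i}) ` C"
    have "\<Union>\<D> \<subseteq> {p..q}" using C(2) by (fastforce simp: \<D>_def K_def)
    have sub: "measure lebesgue (\<Union>\<D>') \<le> q - p" if "\<D>' \<subseteq> \<D>" "finite \<D>'" for \<D>'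
    proof -
      have "measure lebesgue (\<Union>\<D>') \<le> measure lebesgue {p..q}"
        using that \<open>\<Union>\<D> \<subseteq> {p..q}\<close>
        by (intro measure_mono_fmeasurable) (auto simp: \<D>_def intro!: sets.finite_Union)
      then show ?thesis using pq by simp
    qed
    obtain \<D>' where \<D>': "\<D>' \<subseteq> \<D>" "finite \<D>'" "measure lebesgue (\<Union>\<D>) - d < measure lebesgue (\<Union>\<D>')"
      by (rule measure_countable_Union_approachable[of \<D> d "q - p"])
         (use \<open>d > 0\<close> C(1) sub in \<open>auto simp: \<D>_def\<close>)
    obtain F where F: "F \<subseteq> C" "finite F" "\<D>' = (\<lambda>i. {fst i..snd i}) ` F"
      using \<D>'(1,2) unfolding \<D>_def by (meson finite_subset_image)
    have FK: "p \<le> u \<and> u < v \<and> v \<le> q \<and> \<bar>h v - h u\<bar> \<le> e * (v - u)" if "(u, v) \<in> F" for u v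
      using that F(1) C(2) by (auto simp: K_def)
    have "q - p = measure lebesgue {p<..<q}" using pq by simp
    also have "\<dots> \<le> measure lebesgue (\<Union>\<D> \<union> ({u\<in>{p<..<q}. expanding_at h u} \<union>
        (S - (\<Union>i \<in> C. cball (a i) (r i)))))"
    proof (rule measure_mono_fmeasurable)
      have "\<Union>\<D> \<in> lmeasurable"
        by (rule bounded_set_imp_lmeasurable)
           (use C(1) \<open>\<Union>\<D> \<subseteq> {p..q}\<close> bounded_subset[OF bounded_closed_interval] in
             \<open>auto simp: \<D>_def intro!: sets.countable_UN'\<close>)
      then show "\<Union>\<D> \<union> ({u\<in>{p<..<q}. expanding_at h u} \<union>
        (S - (\<Union>i \<in> C. cball (a i) (r i)))) \<in> lmeasurable"
        using neg C(4) by (intro fmeasurable.Un) (auto intro: negligible_imp_measurable)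
    qed (auto simp: S_def \<D>_def cball)
    also have "\<dots> = measure lebesgue (\<Union>\<D>)"
      by (intro measure_Un_null_set)
         (use C(1) neg C(4) in \<open>auto simp: \<D>_def negligible_iff_null_sets[symmetric] intro!: sets.countable_UN'\<close>)
    finally have "q - p - d < measure lebesgue (\<Union>i\<in>F. {fst i..snd i})"
      using \<D>'(3) F(3) by simp
    also have "\<dots> \<le> (\<Sum>i\<in>F. measure lebesgue {fst i..snd i})"
      using F(2) by (intro measure_UNION_le) auto
    also have "\<dots> = (\<Sum>(u, v)\<in>F. v - u)"
      by (intro sum.cong refl) (use FK in \<open>force split: prod.splits\<close>)
    finally have F_large: "q - p - d < (\<Sum>(u, v)\<in>F. v - u)" .
    have pw: "pairwise (\<lambda>i j. disjnt {fst i..snd i} {fst j..snd j}) F"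
      using C(3) F(1) unfolding cball by (rule pairwise_subset)
    from complementary_intervals[of F p q h, OF F(2) pq _ pw] FK
    obtain I where I: "finite I" "\<forall>(a, b)\<in>I. a < b \<and> {a..b} \<subseteq> {p..q}"
           "disjoint_family_on (\<lambda>(a, b). {a<..<b}) I"
           "(\<Sum>(a, b)\<in>I. b - a) = (q - p) - (\<Sum>(u, v)\<in>F. v - u)"
           "\<bar>h q - h p\<bar> \<le> (\<Sum>(u, v)\<in>F. \<bar>h v - h u\<bar>) + (\<Sum>(a, b)\<in>I. \<bar>h b - h a\<bar>)"
      by blast
    have "0 \<le> (\<Sum>(a, b)\<in>I. b - a)"
      using I(2) by (intro sum_nonneg) force
    then have F_small: "(\<Sum>(u, v)\<in>F. v - u) \<le> q - p" using I(4) by simp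
    have "(\<Sum>(u, v)\<in>F. \<bar>h v - h u\<bar>) \<le> (\<Sum>(u, v)\<in>F. e * (v - u))"
      using FK by (intro sum_mono) auto
    also have "\<dots> = e * (\<Sum>(u, v)\<in>F. v - u)"
      by (simp add: sum_distrib_left case_prod_unfold)
    also have "\<dots> \<le> e * (q - p)" using e F_small by simp
    finally have "(\<Sum>(u, v)\<in>F. \<bar>h v - h u\<bar>) \<le> e * (q - p)" .
    moreover have "(\<Sum>(a, b)\<in>I. \<bar>h b - h a\<bar>) < e"
      using d[OF I(1-3)] I(4) F_large by simp
    ultimately show ?thesis using I(5) by linarith
  qed
  note * = this
  have "\<bar>h q - h p\<bar> \<le> 0"
  proof (rule field_le_epsilon)
    fix e :: real assume "e > 0"
    have "\<bar>h q - h p\<bar> \<le> e / (q - p + 1) * (q - p) + e / (q - p + 1)"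
      using \<open>e > 0\<close> pq by (intro *) auto
    also have "\<dots> = e / (q - p + 1) * (q - p + 1)" by (simp only: ring_distribs mult_1_right)
    also have "\<dots> = e" using pq by simp
    finally show "\<bar>h q - h p\<bar> \<le> 0 + e" by simp
  qed
  then show ?thesis by simp
qed

section \<open>Weak derivatives and Hoelder exponents above one\<close>

text \<open>
  Here \<open>h u\<close> is the integral of the indicator of \<open>B\<close> over \<open>{0..u}\<close>. Hence both sides of the defining
  identity come from integrating \<open>indicator B t * deriv \<phi> x\<close> over the triangle \<open>t \<le> x\<close>: first over
  \<open>t\<close>, which gives \<open>h\<close>, or first over \<open>x\<close>, which gives \<open>\<phi> 1 - \<phi> t = - \<phi> t\<close>.
\<close>

lemma weak_derivative_measure_below:
  fixes B :: "real set"
  assumes B[measurable]: "B \<in> sets borel" and B01: "B \<subseteq> {0..1}"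
    and h: "\<And>u. u \<in> {0..1} \<Longrightarrow> h u = measure lborel (B \<inter> {0..u})"
    and cont: "continuous_on {0..1} h"
  shows "has_weak_derivative_on h (indicator B) {0<..<1}"
  unfolding has_weak_derivative_on_def locally_integrable_on_def
proof (intro conjI allI impI ballI)
  fix K :: "real set" assume K: "compact K" "K \<subseteq> {0<..<1}"
  have Kb: "K \<in> sets borel" "K \<subseteq> {0..1}"
    using K by (auto intro: borel_closed compact_imp_closed)
  have "h absolutely_integrable_on {0..1}"
    using absolutely_integrable_continuous_real[OF cont] .
  then show "h absolutely_integrable_on K"
    by (rule set_integrable_subset) (use Kb in auto)
  have "integrable lborel (\<lambda>x. indicator (K \<inter> B) x :: real)"
    using Kb emeasure_mono[of "K \<inter> B" K lborel] emeasure_compact_finite[OF K(1)]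
    by (intro integrable_real_indicator) (auto intro: le_less_trans)
  then have "integrable lebesgue (\<lambda>x. indicator (K \<inter> B) x :: real)"
    by (simp add: integrable_completion)
  then show "(indicator B :: real \<Rightarrow> real) absolutely_integrable_on K"
    unfolding set_integrable_def by (simp add: indicator_inter_arith)
next
  fix \<phi> assume \<phi>: "\<phi> \<in> test_functions {0<..<1 :: real}"
  define S where "S = closure {x. \<phi> x \<noteq> 0}"
  have S: "S \<subseteq> {0<..<1}" "closed S" using \<phi> by (auto simp: test_functions_def S_def)
  have diff: "(deriv ^^ n) \<phi> differentiable at x" for n x
    using \<phi> by (auto simp: test_functions_def)
  have deriv: "(\<phi> has_real_derivative deriv \<phi> x) (at x)" for x
    using diff[of 0 x] by (simp add: DERIV_deriv_iff_real_differentiable)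
  have contd: "isCont (deriv \<phi>) x" for x
    using diff[of 1 x] by (simp add: differentiable_imp_continuous_within)
  have [measurable]: "deriv \<phi> \<in> borel_measurable borel"
    by (intro borel_measurable_continuous_onI continuous_at_imp_continuous_on) (simp add: contd)
  have [measurable]: "\<phi> \<in> borel_measurable borel"
    by (intro borel_measurable_continuous_onI continuous_at_imp_continuous_on)
       (auto intro: DERIV_isCont[OF deriv])
  have zero: "\<phi> x = 0" if "x \<notin> {0<..<1}" for x
    using that S closure_subset[of "{x. \<phi> x \<noteq> 0}"] by (auto simp: S_def)
  \<comment> \<open>Vanishing of \<open>deriv \<phi>\<close> off the open interval makes all integrals over the line agree with those over it.\<close>
  have dzero: "deriv \<phi> x = 0" if "x \<notin> {0<..<1}" for x
  proof -
    have "\<forall>\<^sub>F y in nhds x. y \<in> - S"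
      using that S by (intro eventually_nhds_in_open) auto
    then have "\<forall>\<^sub>F y in nhds x. \<phi> y = 0"
      by eventually_elim (use closure_subset[of "{x. \<phi> x \<noteq> 0}"] in \<open>auto simp: S_def\<close>)
    then have "deriv \<phi> x = deriv (\<lambda>_. 0) x" by (intro deriv_cong_ev) auto
    then show ?thesis by simp
  qed
  have "compact (deriv \<phi> ` {0..1})"
    by (intro compact_continuous_image continuous_at_imp_continuous_on) (auto simp: contd)
  then obtain C where C: "\<forall>x\<in>{0..1}. \<bar>deriv \<phi> x\<bar> \<le> C"
    using compact_imp_bounded[of "deriv \<phi> ` {0..1}"] by (auto simp: bounded_iff)
  have C: "\<bar>deriv \<phi> x\<bar> \<le> C * indicator {0..1} x" for x
    using C dzero[of x] by (cases "x \<in> {0..1}") auto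
  define F where "F = (\<lambda>t x. indicator B t * (if t \<le> x then deriv \<phi> x else 0))"
  have F_int: "integrable (lborel \<Otimes>\<^sub>M lborel) (case_prod F)"
  proof (rule Bochner_Integration.integrable_bound)
    have "emeasure (lborel \<Otimes>\<^sub>M lborel) ({0..1 :: real} \<times> {0..1 :: real}) < \<infinity>"
      by (subst lborel.emeasure_pair_measure_Times) auto
    then show "integrable (lborel \<Otimes>\<^sub>M lborel)
        (\<lambda>p. C * indicator ({0..1 :: real} \<times> {0..1 :: real}) p :: real)"
      by (intro integrable_mult_right integrable_real_indicator) auto
    show "case_prod F \<in> borel_measurable (lborel \<Otimes>\<^sub>M lborel)"
      unfolding F_def by measurable
    show "AE p in lborel \<Otimes>\<^sub>M lborel. norm (case_prod F p)
        \<le> norm (C * indicator ({0..1 :: real} \<times> {0..1 :: real}) p :: real)"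
    proof (rule AE_I2, safe)
      fix t x :: real
      show "norm (F t x) \<le> norm (C * indicator ({0..1} \<times> {0..1}) (t, x) :: real)"
        using C[of x] B01 by (auto simp: F_def indicator_def split: if_splits)
    qed
  qed
  have inner_t: "(LINT t|lborel. F t x) = indicator {0<..<1} x * (h x * deriv \<phi> x)" for x
  proof (cases "x \<in> {0<..<1}")
    case True
    have "(LINT t|lborel. F t x) = (LINT t|lborel. indicator (B \<inter> {0..x}) t * deriv \<phi> x)"
      using B01 by (intro Bochner_Integration.integral_cong) (auto simp: F_def indicator_def)
    also have "\<dots> = measure lborel (B \<inter> {0..x}) * deriv \<phi> x"
      by simp
    finally show ?thesis using True h[of x] by simp
  next
    case False
    then have "F t x = 0" for t by (simp add: F_def dzero)
    then show ?thesis using False by simp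
  qed
  have inner_x: "(LINT x|lborel. F t x) = - (indicator {0<..<1} t * (indicator B t * \<phi> t))" for t
  proof (cases "t \<in> B")
    case True
    then have t: "0 \<le> t" "t \<le> 1" using B01 by auto
    have "(LINT x|lborel. F t x) = (LINT x|lborel. deriv \<phi> x * indicator {t..1} x)"
      using True t dzero by (intro Bochner_Integration.integral_cong) (auto simp: F_def indicator_def)
    also have "\<dots> = \<phi> 1 - \<phi> t"
      using t deriv contd by (intro integral_FTC_Icc_real) auto
    finally show ?thesis using True zero[of 1] zero[of t] by (auto simp: indicator_def)
  next
    case False
    then show ?thesis by (simp add: F_def)
  qed
  have hm: "(\<lambda>x. indicator {0<..<1} x * (h x * deriv \<phi> x)) \<in> borel_measurable lborel"
    unfolding inner_t[symmetric] F_def by measurable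
  have "(LINT x:{0<..<1}|lebesgue. h x * deriv \<phi> x) = (LINT x|lborel. (LINT t|lborel. F t x))"
    unfolding set_lebesgue_integral_def inner_t real_scaleR_def
    by (rule integral_completion[OF hm])
  also have "\<dots> = (LINT t|lborel. (LINT x|lborel. F t x))"
    by (rule lborel_pair.Fubini_integral[OF F_int])
  also have "\<dots> = - (LINT t|lborel. indicator {0<..<1} t * (indicator B t * \<phi> t))"
    by (simp add: inner_x)
  also have "\<dots> = - (LINT t:{0<..<1}|lebesgue. indicator B t * \<phi> t)"
    unfolding set_lebesgue_integral_def real_scaleR_def
    by (subst integral_completion) auto
  finally show "(LINT x:{0<..<1}|lebesgue. h x * deriv \<phi> x) =
      - (LINT t:{0<..<1}|lebesgue. indicator B t * \<phi> t)" .
qed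

text \<open>
  The difference quotients at \<open>x\<close> are bounded by \<open>K * \<bar>y - x\<bar> powr (\<alpha> - 1)\<close>, so the derivative is
  zero everywhere.
\<close>

lemma holder_on_exponent_gt_1_imp_constant_on:
  assumes "holder_on \<alpha> S f" "1 < \<alpha>" "convex S"
  shows "f constant_on S"
proof -
  obtain K where K: "K > 0" "\<And>x y. x \<in> S \<Longrightarrow> y \<in> S \<Longrightarrow> \<bar>f x - f y\<bar> \<le> K * \<bar>x - y\<bar> powr \<alpha>"
    using assms(1) unfolding holder_on_def by blast
  have "\<exists>c. \<forall>x\<in>S. f x = c"
  proof (rule has_field_derivative_zero_constant[OF assms(3)])
    fix x assume x: "x \<in> S"
    have "((\<lambda>y. K * \<bar>y - x\<bar> powr (\<alpha> - 1)) \<longlongrightarrow> K * \<bar>x - x\<bar> powr (\<alpha> - 1)) (at x within S)"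
      using assms(2) by (intro tendsto_intros tendsto_powr') auto
    then have lim: "((\<lambda>y. K * \<bar>y - x\<bar> powr (\<alpha> - 1)) \<longlongrightarrow> 0) (at x within S)"
      using assms(2) by simp
    have "((\<lambda>y. (f y - f x) / (y - x)) \<longlongrightarrow> 0) (at x within S)"
    proof (rule Lim_null_comparison[OF _ lim])
      show "\<forall>\<^sub>F y in at x within S. norm ((f y - f x) / (y - x)) \<le> K * \<bar>y - x\<bar> powr (\<alpha> - 1)"
        unfolding eventually_at_filter
      proof (intro always_eventually allI impI)
        fix y assume y: "y \<noteq> x" "y \<in> S"
        have "\<bar>f y - f x\<bar> \<le> K * \<bar>y - x\<bar> powr \<alpha>" using K(2) x y by blast
        also have "\<bar>y - x\<bar> powr \<alpha> = \<bar>y - x\<bar> powr (\<alpha> - 1) * \<bar>y - x\<bar>"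
          using y by (simp add: powr_diff)
        finally show "norm ((f y - f x) / (y - x)) \<le> K * \<bar>y - x\<bar> powr (\<alpha> - 1)"
          using y by (simp add: divide_le_eq mult.assoc)
      qed
    qed
    then show "(f has_field_derivative 0) (at x within S)"
      by (simp add: has_field_derivative_iff)
  qed
  then show ?thesis by (simp add: constant_on_def)
qed

section \<open>The change of variables by the distribution function\<close>

locale full_nonatomic_measure = prob_space \<Lambda> for \<Lambda> :: "real measure" +
  assumes sets_eq: "sets \<Lambda> = sets (restrict_space borel {0..1})"
    and non_atomic: "non_atomic \<Lambda>"
    and full_support: "full_support \<Lambda>"
begin

abbreviation U :: "real \<Rightarrow> real" where "U \<equiv> dist_fun \<Lambda>"
abbreviation V :: "real \<Rightarrow> real" where "V \<equiv> inv_into {0..1} U"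
definition ball_mass :: "real \<Rightarrow> real \<Rightarrow> real" where
  "ball_mass x r = measure \<Lambda> {y\<in>{0..1}. \<bar>x - y\<bar> < r}"

lemma space_eq: "space \<Lambda> = {0..1}"
  using sets_eq_imp_space_eq[OF sets_eq] by (simp add: space_restrict_space)

lemma sets_iff: "A \<in> sets \<Lambda> \<longleftrightarrow> A \<subseteq> {0..1} \<and> A \<in> sets borel"
  by (auto simp: sets_eq sets_restrict_space_iff)

text \<open>
  With this, intervals and balls may gain or lose end points without changing their mass.
\<close>

lemma AE_neq: "AE y in \<Lambda>. y \<noteq> p"
proof (cases "p \<in> {0..1}")
  case True
  then have "{p} \<in> sets \<Lambda>" "measure \<Lambda> {p} = 0"
    using non_atomic by (auto simp: sets_iff non_atomic_def)
  then have "{p} \<in> null_sets \<Lambda>" by (simp add: null_sets_def emeasure_eq_measure)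
  then show ?thesis by (auto dest: AE_not_in)
next
  case False
  then show ?thesis using AE_space by (auto simp: space_eq elim: eventually_mono)
qed

lemma measure_Icc:
  assumes "0 \<le> x" "x \<le> y" "y \<le> 1"
  shows "measure \<Lambda> {x..y} = U y - U x"
proof -
  have "measure \<Lambda> {x..y} = measure \<Lambda> ({0..y} - {0..x})"
    using assms AE_neq[of x] by (intro measure_eq_AE) (auto simp: sets_iff elim: eventually_mono)
  also have "\<dots> = U y - U x"
    using assms by (subst finite_measure_Diff) (auto simp: sets_iff dist_fun_def)
  finally show ?thesis .
qed

lemma U_0: "U 0 = 0" and U_1: "U 1 = 1"
proof -
  show "U 0 = 0" using non_atomic by (simp add: dist_fun_def non_atomic_def)
  show "U 1 = 1" using prob_space by (simp add: dist_fun_def space_eq)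
qed

lemma open_mass_pos:
  assumes "open W" "W \<inter> {0..1} \<noteq> {}"
  shows "measure \<Lambda> (W \<inter> {0..1}) > 0"
  using full_support assms by (auto simp: full_support_def openin_open Int_commute)

lemma U_strict_mono:
  assumes "0 \<le> x" "x < y" "y \<le> 1"
  shows "U x < U y"
proof -
  have "{x<..<y} \<inter> {0..1} \<noteq> {}"
    using assms dense[of x y] by fastforce
  then have "0 < measure \<Lambda> ({x<..<y} \<inter> {0..1})" by (intro open_mass_pos) auto
  also have "\<dots> \<le> measure \<Lambda> {x..y}"
    using assms by (intro finite_measure_mono) (auto simp: sets_iff)
  finally show ?thesis using measure_Icc[of x y] assms by simp
qed

lemma U_le_iff: "x \<in> {0..1} \<Longrightarrow> y \<in> {0..1} \<Longrightarrow> U x \<le> U y \<longleftrightarrow> x \<le> y"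
  by (metis U_strict_mono atLeastAtMost_iff linorder_not_less order_less_imp_le order_le_less)

text \<open>
  Extending \<open>\<Lambda>\<close> by zero to the real line makes \<open>U\<close> a cumulative distribution function, which is
  continuous at every point that is not an atom.
\<close>

lemma continuous_on_U: "continuous_on {0..1} U"
proof -
  define M where "M = distr \<Lambda> borel (\<lambda>x. x)"
  have m: "(\<lambda>x. x) \<in> measurable \<Lambda> borel"
    by (rule measurableI) (auto simp: space_eq sets_iff Int_def[symmetric] Int_commute)
  interpret M: real_distribution M
    unfolding M_def by (rule real_distribution_distr) (rule m)
  have M: "measure M A = measure \<Lambda> (A \<inter> {0..1})" if "A \<in> sets borel" for A
    using that by (simp add: M_def measure_distr m space_eq)
  have "isCont (cdf M) x" for x
  proof -
    have "measure \<Lambda> ({x} \<inter> {0..1}) = 0"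
      using non_atomic by (cases "x \<in> {0..1}") (auto simp: non_atomic_def Int_insert_left)
    then show ?thesis by (subst M.isCont_cdf) (simp add: M)
  qed
  then have "continuous_on {0..1} (cdf M)" by (simp add: continuous_at_imp_continuous_on)
  moreover have "cdf M x = U x" if "x \<in> {0..1}" for x
  proof -
    have "{..x} \<inter> {0..1} = {0..x}" using that by auto
    moreover have "cdf M x = measure \<Lambda> ({..x} \<inter> {0..1})" by (simp only: cdf_def M atMost_borel)
    ultimately show ?thesis by (simp only: dist_fun_def)
  qed
  ultimately show ?thesis by (rule continuous_on_eq)
qed

lemma U_in: "x \<in> {0..1} \<Longrightarrow> U x \<in> {0..1}"
  using U_le_iff[of 0 x] U_le_iff[of x 1] by (simp add: U_0 U_1)

lemma inj_U: "inj_on U {0..1}"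
  by (intro linorder_inj_onI) (use U_strict_mono in \<open>force+\<close>)

lemma image_U: "U ` {0..1} = {0..1}"
proof
  show "{0..1} \<subseteq> U ` {0..1}"
  proof
    fix u :: real assume "u \<in> {0..1}"
    then have "\<exists>x\<ge>0. x \<le> 1 \<and> U x = u"
      using continuous_on_U by (intro IVT') (auto simp: U_0 U_1)
    then show "u \<in> U ` {0..1}" by force
  qed
qed (use U_in in auto)

lemma V_in: "u \<in> {0..1} \<Longrightarrow> V u \<in> {0..1}"
  using inv_into_into[of u U "{0..1}"] by (simp add: image_U)

lemma U_V: "u \<in> {0..1} \<Longrightarrow> U (V u) = u"
  by (simp add: f_inv_into_f image_U)

lemma V_U: "x \<in> {0..1} \<Longrightarrow> V (U x) = x"
  by (simp add: inj_U)

lemma continuous_on_V: "continuous_on {0..1} V"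
  using continuous_on_inv[OF continuous_on_U, of V] by (simp add: image_U V_U)

lemma image_U_eq: "A \<subseteq> {0..1} \<Longrightarrow> U ` A = V -` A \<inter> {0..1}"
  using U_in V_U U_V by (force simp: image_iff)

lemma image_U_borel:
  assumes "A \<in> sets \<Lambda>"
  shows "U ` A \<in> sets borel"
proof -
  have "V \<in> borel_measurable (restrict_space borel {0..1})"
    by (rule borel_measurable_continuous_on_restrict[OF continuous_on_V])
  then have "V -` A \<inter> {0..1} \<in> sets (restrict_space borel {0..1})"
    using assms measurable_sets[of V "restrict_space borel {0..1}" borel A]
    by (simp add: sets_iff space_restrict_space)
  then show ?thesis
    using assms by (simp add: image_U_eq sets_iff sets_restrict_space_iff)
qed

text \<open>
  The probability integral transform: \<open>U\<close> maps \<open>\<Lambda>\<close> to the uniform distribution on \<open>{0..1}\<close>, as a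
  comparison of distribution functions shows. Since \<open>U\<close> is injective, the preimage of \<open>U ` A\<close> is \<open>A\<close>.
\<close>

lemma emeasure_image_U:
  assumes A: "A \<in> sets \<Lambda>"
  shows "emeasure lborel (U ` A) = emeasure \<Lambda> A"
proof -
  define M where "M = distr \<Lambda> borel U"
  define L :: "real measure" where "L = uniform_measure lborel {0..1}"
  have Um: "U \<in> borel_measurable \<Lambda>"
    using borel_measurable_continuous_on_restrict[OF continuous_on_U]
    by (simp add: measurable_cong_sets[OF sets_eq refl])
  interpret M: real_distribution M
    unfolding M_def by (rule real_distribution_distr) (rule Um)
  interpret L: prob_space L
    unfolding L_def by (intro prob_space_uniform_measure) auto
  have Lr: "real_distribution L"
    by unfold_locales (simp add: L_def)
  have "M = L"
  proof (rule cdf_unique[OF M.real_distribution_axioms Lr], rule ext)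
    fix t :: real
    have M: "cdf M t = measure \<Lambda> {x\<in>{0..1}. U x \<le> t}"
      unfolding cdf_def M_def using Um
      by (simp add: measure_distr space_eq vimage_def Int_def conj_commute)
    have L: "cdf L t = measure lborel ({0..1} \<inter> {..t})"
      by (simp add: cdf_def L_def measure_uniform_measure)
    consider "t < 0" | "t \<in> {0..1}" | "t > 1" by force
    then show "cdf M t = cdf L t"
    proof cases
      case 1
      have "{x\<in>{0..1}. U x \<le> t} = {}" using 1 U_in by force
      moreover have "{0..1} \<inter> {..t} = {}" using 1 by auto
      ultimately show ?thesis by (simp only: M L measure_empty)
    next
      case 2
      have "{x\<in>{0..1}. U x \<le> t} = {0..V t}"
        using V_in[OF 2] U_V[OF 2] U_le_iff[of _ "V t"] by auto
      then have "cdf M t = t" using U_V[OF 2] M by (simp add: dist_fun_def)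
      moreover have "{0..1} \<inter> {..t} = {0..t}" using 2 by auto
      ultimately show ?thesis using 2 L by simp
    next
      case 3
      have "{x\<in>{0..1}. U x \<le> t} = {0..1}" using 3 U_in by force
      moreover have "{0..1} \<inter> {..t} = {0..1}" using 3 by auto
      ultimately show ?thesis using M L U_1 by (simp add: dist_fun_def)
    qed
  qed
  have A': "A \<subseteq> {0..1}" "U ` A \<subseteq> {0..1}" using A U_in by (auto simp: sets_iff)
  have "emeasure lborel (U ` A) = emeasure L (U ` A)"
    using A' image_U_borel[OF A]
    by (simp add: L_def emeasure_uniform_measure Int_absorb1 divide_ennreal_def)
  also have "\<dots> = emeasure \<Lambda> (U -` (U ` A) \<inter> space \<Lambda>)"
    unfolding \<open>M = L\<close>[symmetric] M_def using image_U_borel[OF A] Um by (simp add: emeasure_distr)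
  also have "U -` (U ` A) \<inter> space \<Lambda> = A"
    using A' inj_U by (auto simp: space_eq inj_on_def)
  finally show ?thesis .
qed

lemma negligible_image_U:
  assumes "N \<in> null_sets \<Lambda>"
  shows "negligible (U ` N)"
proof -
  have "U ` N \<in> null_sets lborel"
    using assms image_U_borel emeasure_image_U by (simp add: null_sets_def)
  then show ?thesis by (simp add: negligible_iff_null_sets null_sets_completionI)
qed

section \<open>Ball masses and the lower local dimension\<close>

text \<open>
  The clipped formula exhibits ball masses as continuous functions of the centre.
\<close>

lemma ball_mass_eq:
  assumes "x \<in> {0..1}" "0 < r"
  shows "ball_mass x r = U (min 1 (x + r)) - U (max 0 (x - r))"
proof -
  have "ball_mass x r = measure \<Lambda> {max 0 (x - r)..min 1 (x + r)}"
    unfolding ball_mass_def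
  proof (rule measure_eq_AE)
    show "AE y in \<Lambda>. y \<in> {y\<in>{0..1}. \<bar>x - y\<bar> < r} \<longleftrightarrow> y \<in> {max 0 (x - r)..min 1 (x + r)}"
      using AE_neq[of "x - r"] AE_neq[of "x + r"] by eventually_elim auto
    have "{y\<in>{0..1}. \<bar>x - y\<bar> < r} = {0..1} \<inter> {x - r<..<x + r}" by auto
    then show "{y\<in>{0..1}. \<bar>x - y\<bar> < r} \<in> sets \<Lambda>" by (simp add: sets_iff)
  qed (auto simp: sets_iff)
  also have "\<dots> = U (min 1 (x + r)) - U (max 0 (x - r))"
    using assms by (intro measure_Icc) auto
  finally show ?thesis .
qed

lemma ball_mass_pos:
  assumes "x \<in> {0..1}" "0 < r"
  shows "ball_mass x r > 0"
proof -
  have "{x - r<..<x + r} \<inter> {0..1} = {y\<in>{0..1}. \<bar>x - y\<bar> < r}" by auto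
  moreover have "x \<in> {x - r<..<x + r} \<inter> {0..1}" using assms by auto
  then have "measure \<Lambda> ({x - r<..<x + r} \<inter> {0..1}) > 0"
    by (intro open_mass_pos open_greaterThanLessThan) blast
  ultimately show ?thesis by (simp only: ball_mass_def)
qed

text \<open>
  The points at which \<open>\<Lambda>\<close> satisfies a Frostman bound of exponent \<open>b\<close> up to scale \<open>R\<close>.
  A constant factor in the bound would give nothing new in the limit: lowering \<open>b\<close> and \<open>R\<close> absorbs it.
\<close>

definition frostman_set :: "real \<Rightarrow> real \<Rightarrow> real set" where
  "frostman_set b R = {x\<in>{0..1}. \<forall>r. 0 < r \<longrightarrow> r < R \<longrightarrow> ball_mass x r \<le> r powr b}"

lemma closed_frostman_set: "closed (frostman_set b R)"
proof -
  have eq: "frostman_set b R = {0..1} \<inter> (\<Inter>r\<in>{0<..<R}.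
      {x\<in>{0..1}. U (min 1 (x + r)) - U (max 0 (x - r)) \<le> r powr b})"
    by (auto simp: frostman_set_def ball_mass_eq)
  have *: "closed {x\<in>{0..1}. U (min 1 (x + r)) - U (max 0 (x - r)) \<le> r powr b}"
    if "0 < r" for r
  proof -
    have "continuous_on {0..1} (\<lambda>x. U (min 1 (x + r)))"
      by (rule continuous_on_compose2[OF continuous_on_U])
         (use that in \<open>auto intro!: continuous_intros\<close>)
    moreover have "continuous_on {0..1} (\<lambda>x. U (max 0 (x - r)))"
      by (rule continuous_on_compose2[OF continuous_on_U])
         (use that in \<open>auto intro!: continuous_intros\<close>)
    ultimately show ?thesis
      by (intro continuous_on_closed_Collect_le continuous_intros) auto
  qed
  show ?thesis unfolding eq by (intro closed_Int closed_INT ballI *) auto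
qed

lemma frostman_set_sets: "frostman_set b R \<in> sets \<Lambda>"
  using closed_frostman_set by (auto simp: sets_iff frostman_set_def borel_closed)

text \<open>
  Dividing by \<open>ln r < 0\<close> reverses the inequality.
\<close>

lemma local_quotient_ge_iff:
  assumes "x \<in> {0..1}" "0 < r" "r < 1"
  shows "b \<le> ln (ball_mass x r) / ln r \<longleftrightarrow> ball_mass x r \<le> r powr b"
proof -
  have "b \<le> ln (ball_mass x r) / ln r \<longleftrightarrow> ln (ball_mass x r) \<le> ln (r powr b)"
    using assms by (simp add: neg_le_divide_eq ln_powr)
  also have "\<dots> \<longleftrightarrow> ball_mass x r \<le> r powr b"
    using assms ball_mass_pos[of x r] by (intro ln_le_cancel_iff) auto
  finally show ?thesis .
qed

lemma lower_local_dim_eq: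
  "lower_local_dim \<Lambda> x = Liminf (at_right 0)
     (\<lambda>r. if ball_mass x r = 0 then \<infinity> else ereal (ln (ball_mass x r) / ln r))"
  by (simp only: lower_local_dim_def ball_mass_def Let_def)

lemma lower_local_dim_geI:
  assumes x: "x \<in> {0..1}" and ev: "\<forall>\<^sub>F r in at_right 0. ball_mass x r \<le> r powr b"
  shows "ereal b \<le> lower_local_dim \<Lambda> x"
  unfolding lower_local_dim_eq
proof (rule Liminf_bounded)
  have "\<forall>\<^sub>F r in at_right 0. 0 < r \<and> r < (1 :: real)"
    by (auto simp: eventually_at_right_field intro: exI[of _ 1])
  with ev show "\<forall>\<^sub>F r in at_right 0. ereal b \<le>
      (if ball_mass x r = 0 then \<infinity> else ereal (ln (ball_mass x r) / ln r))"
    by eventually_elim (use x local_quotient_ge_iff in auto)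
qed

text \<open>
  Radii \<open>1 / Suc n\<close> suffice, and they stay at most one, where the sign of \<open>ln r\<close> is known. Together
  with the next lemma this describes the lower local dimension, up to strictness, by countably many
  Frostman sets.
\<close>

lemma less_lower_local_dimD:
  assumes x: "x \<in> {0..1}" and less: "ereal b < lower_local_dim \<Lambda> x"
  obtains n where "x \<in> frostman_set b (1 / Suc n)"
proof -
  have "\<forall>\<^sub>F r in at_right 0. ereal b <
      (if ball_mass x r = 0 then \<infinity> else ereal (ln (ball_mass x r) / ln r))"
    using less_LiminfD[OF less[unfolded lower_local_dim_eq]] .
  then obtain R where R: "R > 0" "\<And>r. 0 < r \<Longrightarrow> r < R \<Longrightarrow> ereal b <
      (if ball_mass x r = 0 then \<infinity> else ereal (ln (ball_mass x r) / ln r))"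
    unfolding eventually_at_right_field by auto
  obtain n where n: "1 / Suc n < R"
    using reals_Archimedean[OF R(1)] by (auto simp: inverse_eq_divide)
  have "ball_mass x r \<le> r powr b" if "0 < r" "r < 1 / Suc n" for r
  proof -
    have "1 / Suc n \<le> (1 :: real)" by simp
    then have "r < 1" using that by linarith
    moreover have "b < ln (ball_mass x r) / ln r"
      using R(2)[of r] that n ball_mass_pos[OF x, of r] by (simp split: if_splits)
    ultimately show ?thesis
      using that by (intro local_quotient_ge_iff[OF x, THEN iffD1]) auto
  qed
  then show thesis using x by (intro that[of n]) (auto simp: frostman_set_def)
qed

lemma frostman_set_lower_local_dim:
  assumes "x \<in> frostman_set b R" "0 < R"
  shows "ereal b \<le> lower_local_dim \<Lambda> x"
  using assms
  by (intro lower_local_dim_geI) (auto simp: frostman_set_def eventually_at_right_field intro: exI[of _ R])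

lemma lower_local_dim_nonneg:
  assumes "x \<in> {0..1}"
  shows "0 \<le> lower_local_dim \<Lambda> x"
proof -
  have "\<forall>\<^sub>F r in at_right 0. ball_mass x r \<le> r powr 0"
    by (auto simp: eventually_at_right_field ball_mass_def intro: exI[of _ 1])
  from lower_local_dim_geI[OF assms this] show ?thesis by (simp add: zero_ereal_def)
qed

text \<open>
  The limit inferior runs over uncountably many radii, so measurability is not automatic. The
  superlevel sets are countable unions of the closed Frostman sets with rational exponents.
\<close>

lemma lower_local_dim_measurable: "lower_local_dim \<Lambda> \<in> borel_measurable \<Lambda>"
proof (rule borel_measurableI_greater)
  fix a :: ereal
  have "{x\<in>space \<Lambda>. a < lower_local_dim \<Lambda> x} =
      (\<Union>q\<in>{q :: rat. a < ereal (of_rat q)}. \<Union>n. frostman_set (of_rat q) (1 / Suc n))"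
  proof (intro set_eqI iffI)
    fix x assume "x \<in> {x\<in>space \<Lambda>. a < lower_local_dim \<Lambda> x}"
    then have x: "x \<in> {0..1}" "a < lower_local_dim \<Lambda> x" by (auto simp: space_eq)
    obtain q where q: "a < ereal (of_rat q)" "ereal (of_rat q) < lower_local_dim \<Lambda> x"
      using ereal_dense3[OF x(2)] by blast
    obtain n where "x \<in> frostman_set (of_rat q) (1 / Suc n)"
      by (rule less_lower_local_dimD[OF x(1) q(2)])
    with q(1) show "x \<in> (\<Union>q\<in>{q :: rat. a < ereal (of_rat q)}. \<Union>n. frostman_set (of_rat q) (1 / Suc n))"
      by (intro UN_I[of q] UN_I[of n]) simp_all
  next
    fix x assume "x \<in> (\<Union>q\<in>{q :: rat. a < ereal (of_rat q)}. \<Union>n. frostman_set (of_rat q) (1 / Suc n))"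
    then obtain q n where q: "a < ereal (of_rat q)" "x \<in> frostman_set (of_rat q) (1 / Suc n)"
      by blast
    then have "a < lower_local_dim \<Lambda> x"
      using frostman_set_lower_local_dim[OF q(2)] by (simp add: less_le_trans)
    then show "x \<in> {x\<in>space \<Lambda>. a < lower_local_dim \<Lambda> x}"
      using q(2) by (auto simp: space_eq frostman_set_def)
  qed
  then show "{x\<in>space \<Lambda>. a < lower_local_dim \<Lambda> x} \<in> sets \<Lambda>"
    using frostman_set_sets by (auto intro!: sets.countable_UN'')
qed

lemma upper_hausdorff_dim_nonneg: "0 \<le> upper_hausdorff_dim \<Lambda>"
proof -
  have "AE x in \<Lambda>. 0 \<le> upper_hausdorff_dim \<Lambda>"
    using esssup_AE[of "lower_local_dim \<Lambda>" \<Lambda>] AE_space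
    by eventually_elim
       (auto simp: upper_hausdorff_dim_def space_eq intro: order_trans[OF lower_local_dim_nonneg])
  then show ?thesis by simp
qed

section \<open>Hoelder functions below the dimension\<close>

lemma restricted_dist_fun_mono_diff:
  assumes A: "A \<in> sets \<Lambda>" and xy: "0 \<le> x" "x \<le> y" "y \<le> 1"
  shows "measure \<Lambda> (A \<inter> {0..y}) - measure \<Lambda> (A \<inter> {0..x}) = measure \<Lambda> (A \<inter> {x<..y})"
proof -
  have "A \<inter> {0..y} - A \<inter> {0..x} = A \<inter> {x<..y}" using xy by auto
  moreover have "measure \<Lambda> (A \<inter> {0..y} - A \<inter> {0..x}) =
      measure \<Lambda> (A \<inter> {0..y}) - measure \<Lambda> (A \<inter> {0..x})"
    by (rule finite_measure_Diff) (use A xy in \<open>auto simp: sets_iff\<close>)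
  ultimately show ?thesis by simp
qed

lemma restricted_dist_fun_lipschitz:
  assumes A: "A \<in> sets \<Lambda>" and xy: "x \<in> {0..1}" "y \<in> {0..1}"
  shows "\<bar>measure \<Lambda> (A \<inter> {0..y}) - measure \<Lambda> (A \<inter> {0..x})\<bar> \<le> \<bar>U y - U x\<bar>"
  using xy
proof (induction x y rule: linorder_wlog)
  case (le x y)
  have "measure \<Lambda> (A \<inter> {x<..y}) \<le> measure \<Lambda> {x..y}"
    using le by (intro finite_measure_mono) (auto simp: sets_iff)
  then show ?case
    using le restricted_dist_fun_mono_diff[OF A, of x y] measure_Icc[of x y] by simp
qed (simp add: abs_minus_commute)

text \<open>
  In the coordinate \<open>u = U x\<close> the function becomes \<open>u \<mapsto> measure lborel (U ` A \<inter> {0..u})\<close>, because \<open>U\<close>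
  preserves order and carries \<open>\<Lambda>\<close> to Lebesgue measure. It is 1-Lipschitz, hence absolutely
  continuous, and its weak derivative is the indicator of \<open>U ` A\<close>.
\<close>

lemma restricted_dist_fun_in_dirichlet_domain:
  assumes A: "A \<in> sets \<Lambda>"
  shows "(\<lambda>x. measure \<Lambda> (A \<inter> {0..x})) \<in> dirichlet_domain \<Lambda>"
proof -
  define f where "f x = measure \<Lambda> (A \<inter> {0..x})" for x
  define h where "h = f \<circ> V"
  have A01: "A \<subseteq> {0..1}" using A by (simp add: sets_iff)
  have h_lip: "\<bar>h v - h u\<bar> \<le> \<bar>v - u\<bar>" if "u \<in> {0..1}" "v \<in> {0..1}" for u v
    using restricted_dist_fun_lipschitz[OF A V_in[OF that(1)] V_in[OF that(2)]] that
    by (simp add: h_def f_def U_V)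
  have h_cont: "continuous_on {0..1} h"
    by (rule lipschitz_on_continuous_on[of 1], rule lipschitz_onI)
       (use h_lip in \<open>auto simp: dist_real_def\<close>)
  have "continuous_on {0..1} (h \<circ> U)"
    by (rule continuous_on_compose[OF continuous_on_U]) (simp add: image_U h_cont)
  moreover have "(h \<circ> U) x = f x" if "x \<in> {0..1}" for x
    using that by (simp add: h_def V_U)
  ultimately have f_cont: "continuous_on {0..1} f" by (rule continuous_on_eq)
  have h_eq: "h u = measure lborel (U ` A \<inter> {0..u})" if u: "u \<in> {0..1}" for u
  proof -
    have "A \<inter> {0..V u} \<in> sets \<Lambda>" using A by (auto simp: sets_iff)
    moreover have "U ` (A \<inter> {0..V u}) = U ` A \<inter> {0..u}"
    proof -
      have "U x \<in> {0..u} \<longleftrightarrow> x \<in> {0..V u}" if "x \<in> A" for x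
        using that A01 U_in[of x] U_le_iff[OF _ V_in[OF u], of x] U_V[OF u] by auto
      then show ?thesis by blast
    qed
    ultimately show ?thesis
      using emeasure_image_U[of "A \<inter> {0..V u}"] by (simp add: h_def f_def measure_def)
  qed
  have "has_weak_derivative_on h (indicator (U ` A)) {0<..<1}"
    using A01 U_in by (intro weak_derivative_measure_below image_U_borel[OF A] h_eq h_cont) auto
  moreover have "square_integrable_on (indicator (U ` A)) {0..1}"
    unfolding square_integrable_on_def
  proof
    have [measurable]: "U ` A \<in> sets lebesgue" using image_U_borel[OF A] by simp
    show "(indicator (U ` A) :: real \<Rightarrow> real) \<in> borel_measurable (lebesgue_on {0..1})"
      by (intro borel_measurable_restrict_space_iff[THEN iffD2] measurable_restrict_space1) measurable
    interpret L: finite_measure "lebesgue_on {0..1 :: real}"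
      by (intro finite_measure_lebesgue_on) auto
    show "integrable (lebesgue_on {0..1}) (\<lambda>x. (indicator (U ` A) x :: real)\<^sup>2)"
      by (rule L.integrable_const_bound[of _ 1])
         (auto simp: indicator_def intro!: measurable_restrict_space1)
  qed
  moreover have "absolutely_continuous_on {0..1} h"
    by (rule lipschitz_imp_absolutely_continuous_on) (rule h_lip)
  ultimately show ?thesis
    using f_cont unfolding dirichlet_domain_def Let_def h_def f_def by blast
qed

text \<open>
  The increment over \<open>{x<..y}\<close> is the mass of \<open>A \<inter> {x<..y}\<close>. If this set is non-empty, it is contained
  in a ball of radius \<open>2 * (y - x)\<close> around one of its points, to which the Frostman bound applies
  when \<open>2 * (y - x) < R\<close>. For longer intervals the trivial bound by the total mass one is enough.
\<close>

lemma restricted_dist_fun_holder: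
  assumes A: "A \<in> sets \<Lambda>" and AF: "A \<subseteq> frostman_set \<alpha> R" and "0 < R" "0 < \<alpha>"
  shows "holder_on \<alpha> {0..1} (\<lambda>x. measure \<Lambda> (A \<inter> {0..x}))"
proof -
  define f where "f x = measure \<Lambda> (A \<inter> {0..x})" for x
  \<comment> \<open>The first summand serves intervals with \<open>2 * (y - x) \<ge> R\<close>, the second one shorter intervals.\<close>
  define K where "K = (2 / R) powr \<alpha> + 2 powr \<alpha>"
  have bound: "\<bar>f y - f x\<bar> \<le> K * \<bar>y - x\<bar> powr \<alpha>" if "x \<in> {0..1}" "y \<in> {0..1}" for x y
    using that
  proof (induction x y rule: linorder_wlog)
    case (le x y)
    have f_diff: "f y - f x = measure \<Lambda> (A \<inter> {x<..y})"
      unfolding f_def using le by (intro restricted_dist_fun_mono_diff A) auto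
    have "measure \<Lambda> (A \<inter> {x<..y}) \<le> K * (y - x) powr \<alpha>"
    proof (cases "A \<inter> {x<..y} = {}")
      case True
      then show ?thesis by (simp add: K_def)
    next
      case False
      then obtain z where z: "z \<in> A" "x < z" "z \<le> y" by auto
      show ?thesis
      proof (cases "2 * (y - x) < R")
        case True
        have "measure \<Lambda> (A \<inter> {x<..y}) \<le> ball_mass z (2 * (y - x))"
          unfolding ball_mass_def
        proof (rule finite_measure_mono)
          show "A \<inter> {x<..y} \<subseteq> {w\<in>{0..1}. \<bar>z - w\<bar> < 2 * (y - x)}" using le z by auto
          have "{w\<in>{0..1}. \<bar>z - w\<bar> < 2 * (y - x)} =
              {0..1} \<inter> {z - 2 * (y - x)<..<z + 2 * (y - x)}" by auto
          then show "{w\<in>{0..1}. \<bar>z - w\<bar> < 2 * (y - x)} \<in> sets \<Lambda>" by (simp add: sets_iff)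
        qed
        also have "\<dots> \<le> (2 * (y - x)) powr \<alpha>"
          using z AF True by (auto simp: frostman_set_def)
        also have "\<dots> = 2 powr \<alpha> * (y - x) powr \<alpha>"
          by (rule powr_mult)
        also have "\<dots> \<le> K * (y - x) powr \<alpha>"
          by (intro mult_right_mono) (auto simp: K_def)
        finally show ?thesis .
      next
        case False
        have "measure \<Lambda> (A \<inter> {x<..y}) \<le> 1 powr \<alpha>" by simp
        also have "\<dots> \<le> (2 / R * (y - x)) powr \<alpha>"
          using False assms by (intro powr_mono2) (auto simp: field_simps)
        also have "\<dots> = (2 / R) powr \<alpha> * (y - x) powr \<alpha>"
          by (rule powr_mult)
        also have "\<dots> \<le> K * (y - x) powr \<alpha>"
          by (intro mult_right_mono) (auto simp: K_def)
        finally show ?thesis .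
      qed
    qed
    then show ?case using f_diff le by simp
  qed (simp add: abs_minus_commute)
  have "K > 0" unfolding K_def using \<open>0 < R\<close> by (intro add_pos_pos) auto
  then show ?thesis
    unfolding holder_on_def f_def[symmetric]
    by (intro exI[of _ K]) (use bound in \<open>simp add: abs_minus_commute\<close>)
qed

text \<open>
  The points of local dimension above \<open>\<alpha>\<close> have positive measure and are covered by countably many
  Frostman sets, so one of these has positive measure; its distribution function is the required \<open>f\<close>.
\<close>

lemma ex_holder_below_upper_hausdorff_dim:
  assumes "0 < \<alpha>" "ereal \<alpha> < upper_hausdorff_dim \<Lambda>"
  obtains f where "f \<in> dirichlet_domain \<Lambda>" "\<not> f constant_on {0..1}" "holder_on \<alpha> {0..1} f"
proof -
  have pos: "0 < emeasure \<Lambda> {x\<in>space \<Lambda>. ereal \<alpha> < lower_local_dim \<Lambda> x}"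
    using assms(2) unfolding upper_hausdorff_dim_def
    by (rule esssup_pos_measure[OF lower_local_dim_measurable])
  have "\<exists>n. emeasure \<Lambda> (frostman_set \<alpha> (1 / Suc n)) \<noteq> 0"
  proof (rule ccontr)
    assume "\<not> ?thesis"
    then have null: "(\<Union>n. frostman_set \<alpha> (1 / Suc n)) \<in> null_sets \<Lambda>"
      by (intro null_sets_UN) (auto simp: null_sets_def frostman_set_sets)
    have "{x\<in>space \<Lambda>. ereal \<alpha> < lower_local_dim \<Lambda> x} \<subseteq> (\<Union>n. frostman_set \<alpha> (1 / Suc n))"
    proof
      fix x assume "x \<in> {x\<in>space \<Lambda>. ereal \<alpha> < lower_local_dim \<Lambda> x}"
      then have "x \<in> {0..1}" "ereal \<alpha> < lower_local_dim \<Lambda> x" by (simp_all add: space_eq)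
      then obtain n where "x \<in> frostman_set \<alpha> (1 / Suc n)" by (rule less_lower_local_dimD)
      then show "x \<in> (\<Union>n. frostman_set \<alpha> (1 / Suc n))" by blast
    qed
    then have "emeasure \<Lambda> {x\<in>space \<Lambda>. ereal \<alpha> < lower_local_dim \<Lambda> x} \<le>
        emeasure \<Lambda> (\<Union>n. frostman_set \<alpha> (1 / Suc n))"
      using null by (intro emeasure_mono) auto
    with pos null_setsD1[OF null] show False by simp
  qed
  then obtain n where n: "emeasure \<Lambda> (frostman_set \<alpha> (1 / Suc n)) \<noteq> 0" by blast
  define E where "E = frostman_set \<alpha> (1 / Suc n)"
  have E: "E \<in> sets \<Lambda>" "E \<subseteq> {0..1}" "measure \<Lambda> E \<noteq> 0"
    using n frostman_set_sets by (auto simp: E_def sets_iff emeasure_eq_measure)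
  show thesis
  proof (rule that)
    show "(\<lambda>x. measure \<Lambda> (E \<inter> {0..x})) \<in> dirichlet_domain \<Lambda>"
      by (rule restricted_dist_fun_in_dirichlet_domain[OF E(1)])
    show "holder_on \<alpha> {0..1} (\<lambda>x. measure \<Lambda> (E \<inter> {0..x}))"
      using assms(1) E by (intro restricted_dist_fun_holder[where R = "1 / Suc n"]) (auto simp: E_def)
    show "\<not> (\<lambda>x. measure \<Lambda> (E \<inter> {0..x})) constant_on {0..1}"
    proof
      assume "(\<lambda>x. measure \<Lambda> (E \<inter> {0..x})) constant_on {0..1}"
      then obtain y where y: "\<And>x. x \<in> {0..1} \<Longrightarrow> measure \<Lambda> (E \<inter> {0..x}) = y"
        by (auto simp: constant_on_def)
      have "measure \<Lambda> (E \<inter> {0..0}) = measure \<Lambda> (E \<inter> {0..1})"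
        using y[of 0] y[of 1] by simp
      moreover have "measure \<Lambda> (E \<inter> {0..0}) = 0"
        using finite_measure_mono[of "E \<inter> {0..0}" "{0}"] non_atomic
        by (auto simp: non_atomic_def sets_iff intro: antisym)
      ultimately show False using E by (simp add: Int_absorb2)
    qed
  qed
qed

section \<open>Hoelder exponents are bounded by the dimension\<close>

text \<open>
  Expansion of \<open>f \<circ> V\<close> at \<open>u\<close> turns the Hoelder bound of \<open>f\<close> at \<open>x = V u\<close> into
  \<open>\<bar>U y - u\<bar> \<le> K / c * \<bar>y - x\<bar> powr \<alpha>\<close> for \<open>y\<close> near \<open>x\<close>. Taking \<open>y = x + r\<close> and \<open>y = x - r\<close> bounds the
  mass of the ball of radius \<open>r\<close> by \<open>2 * K / c * r powr \<alpha>\<close>.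
\<close>

lemma lower_local_dim_ge_at_expanding_point:
  assumes hol: "holder_on \<alpha> {0..1} f" and u: "u \<in> {0<..<1}" and ex: "expanding_at (f \<circ> V) u"
  shows "ereal \<alpha> \<le> lower_local_dim \<Lambda> (V u)"
proof -
  define x where "x = V u"
  have x01: "x \<in> {0..1}" "U x = u" using u V_in[of u] by (auto simp: x_def U_V)
  have "x \<noteq> 0" "x \<noteq> 1" using x01(2) u U_0 U_1 by auto
  then have x: "0 < x" "x < 1" using x01 by auto
  obtain K where K: "K > 0" "\<And>x y. x \<in> {0..1} \<Longrightarrow> y \<in> {0..1} \<Longrightarrow> \<bar>f x - f y\<bar> \<le> K * \<bar>x - y\<bar> powr \<alpha>"
    using hol unfolding holder_on_def by blast
  obtain c where c: "c > 0" "\<forall>\<^sub>F v in nhds u. c * \<bar>v - u\<bar> \<le> \<bar>f (V v) - f (V u)\<bar>"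
    using ex by (auto simp: expanding_at_def)
  have "isCont U x"
    using continuous_on_interior[OF continuous_on_U, of x] x by simp
  then have "(U \<longlongrightarrow> U x) (nhds x)"
    unfolding isCont_def tendsto_at_iff_tendsto_nhds .
  then have "filterlim U (nhds u) (nhds x)"
    by (simp only: x01(2))
  then have "\<forall>\<^sub>F y in nhds x. c * \<bar>U y - u\<bar> \<le> \<bar>f (V (U y)) - f x\<bar>"
    using c(2) unfolding x_def by (rule eventually_compose_filterlim[rotated])
  then have "\<forall>\<^sub>F y in nhds x. c * \<bar>U y - u\<bar> \<le> \<bar>f (V (U y)) - f x\<bar> \<and> y \<in> {0<..<1}"
    using x by (intro eventually_conj eventually_nhds_in_open) auto
  then obtain d where d: "d > 0"
    "\<And>y. dist y x < d \<Longrightarrow> c * \<bar>U y - u\<bar> \<le> \<bar>f (V (U y)) - f x\<bar> \<and> y \<in> {0<..<1}"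
    unfolding eventually_nhds_metric by blast
  have near: "\<bar>U y - u\<bar> \<le> K / c * \<bar>y - x\<bar> powr \<alpha> \<and> y \<in> {0<..<1}" if "\<bar>y - x\<bar> < d" for y
  proof -
    have y: "c * \<bar>U y - u\<bar> \<le> \<bar>f y - f x\<bar>" "y \<in> {0<..<1}"
      using d(2)[of y] that V_U[of y] by (auto simp: dist_real_def)
    have "\<bar>f y - f x\<bar> \<le> K * \<bar>y - x\<bar> powr \<alpha>" using y x01 by (intro K) auto
    with y(1) have "c * \<bar>U y - u\<bar> \<le> K * \<bar>y - x\<bar> powr \<alpha>" by linarith
    then show ?thesis using c(1) y(2) by (simp add: field_simps)
  qed
  have mass: "ball_mass x r \<le> 2 * K / c * r powr \<alpha>" if r: "0 < r" "r < d" for r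
  proof -
    have "ball_mass x r = U (x + r) - U (x - r)"
      using near[of "x + r"] near[of "x - r"] r x01 by (subst ball_mass_eq) auto
    also have "\<dots> \<le> \<bar>U (x + r) - u\<bar> + \<bar>U (x - r) - u\<bar>" by simp
    also have "\<dots> \<le> K / c * r powr \<alpha> + K / c * r powr \<alpha>"
      using near[of "x + r"] near[of "x - r"] r by (intro add_mono) auto
    finally show ?thesis by simp
  qed
  \<comment> \<open>An exponent \<open>b < \<alpha>\<close> leaves room to absorb the constant \<open>2 * K / c\<close> at small scales.\<close>
  have dim: "ereal b \<le> lower_local_dim \<Lambda> x" if "b < \<alpha>" for b
  proof (rule lower_local_dim_geI[OF x01(1)])
    have "((\<lambda>r. 2 * K / c * r powr (\<alpha> - b)) \<longlongrightarrow> 2 * K / c * 0 powr (\<alpha> - b)) (at_right 0)"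
      using that by (intro tendsto_intros tendsto_powr') (auto simp: eventually_at_filter)
    then have "\<forall>\<^sub>F r in at_right 0. 2 * K / c * r powr (\<alpha> - b) < 1"
      by (rule order_tendstoD) simp
    moreover have "\<forall>\<^sub>F r in at_right 0. 0 < r \<and> r < d"
      using d(1) by (auto simp: eventually_at_right_field intro: exI[of _ d])
    ultimately show "\<forall>\<^sub>F r in at_right 0. ball_mass x r \<le> r powr b"
    proof eventually_elim
      case (elim r)
      have "ball_mass x r \<le> 2 * K / c * r powr \<alpha>" using elim by (intro mass) auto
      also have "\<dots> = (2 * K / c * r powr (\<alpha> - b)) * r powr b"
        by (simp add: powr_add[symmetric])
      also have "\<dots> \<le> 1 * r powr b" using elim by (intro mult_right_mono) auto
      finally show ?case by simp
    qed
  qed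
  have "ereal \<alpha> \<le> lower_local_dim \<Lambda> x"
  proof (rule ccontr)
    assume "\<not> ?thesis"
    then obtain b where "lower_local_dim \<Lambda> x < ereal b" "ereal b < ereal \<alpha>"
      using ereal_dense2[of "lower_local_dim \<Lambda> x" "ereal \<alpha>"] by (auto simp: not_le)
    with dim[of b] show False by simp
  qed
  then show ?thesis by (simp add: x_def)
qed

text \<open>
  If the dimension were less than \<open>\<alpha>\<close>, the images under \<open>V\<close> of the expanding points of \<open>f \<circ> V\<close> would
  lie in a \<open>\<Lambda>\<close>-null set. As \<open>U\<close> maps \<open>\<Lambda>\<close>-null sets to Lebesgue null sets, almost no point would be
  expanding, which makes \<open>f \<circ> V\<close> constant.
\<close>

lemma holder_exponent_le_upper_hausdorff_dim:
  assumes f: "f \<in> dirichlet_domain \<Lambda>" "\<not> f constant_on {0..1}" and hol: "holder_on \<alpha> {0..1} f"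
  shows "ereal \<alpha> \<le> upper_hausdorff_dim \<Lambda>"
proof (rule ccontr)
  assume "\<not> ?thesis"
  then have less: "upper_hausdorff_dim \<Lambda> < ereal \<alpha>" by simp
  define h where "h = f \<circ> V"
  have ac: "absolutely_continuous_on {0..1} h"
    using f(1) by (auto simp: dirichlet_domain_def Let_def h_def)
  have hU: "h (U x) = f x" if "x \<in> {0..1}" for x using that by (simp add: h_def V_U)
  have "AE x in \<Lambda>. lower_local_dim \<Lambda> x < ereal \<alpha>"
    using esssup_AE[of "lower_local_dim \<Lambda>" \<Lambda>] less
    by (auto simp: upper_hausdorff_dim_def elim: eventually_mono)
  then obtain N where N: "\<And>x. x \<in> space \<Lambda> - N \<Longrightarrow> lower_local_dim \<Lambda> x < ereal \<alpha>" "N \<in> null_sets \<Lambda>"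
    using AE_E3 by blast
  have "{u\<in>{0<..<1}. expanding_at h u} \<subseteq> U ` N"
  proof
    fix u assume u: "u \<in> {u\<in>{0<..<1}. expanding_at h u}"
    then have "ereal \<alpha> \<le> lower_local_dim \<Lambda> (V u)"
      using hol by (intro lower_local_dim_ge_at_expanding_point) (auto simp: h_def)
    moreover have "V u \<in> space \<Lambda>" unfolding space_eq using u by (intro V_in) auto
    ultimately have "V u \<in> N" using N(1)[of "V u"] by force
    moreover have "u = U (V u)" using u by (simp add: U_V)
    ultimately show "u \<in> U ` N" by blast
  qed
  then have neg: "negligible {u\<in>{0<..<1}. expanding_at h u}"
    using negligible_image_U[OF N(2)] negligible_subset by blast
  have h_eq: "h p = h q" if "p \<in> {0..1}" "q \<in> {0..1}" "p \<le> q" for p q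
  proof (rule absolutely_continuous_nonexpanding_imp_eq[where h = h and p = p and q = q])
    show "absolutely_continuous_on {p..q} h"
      using ac by (rule absolutely_continuous_on_subset) (use that in auto)
    show "negligible {u\<in>{p<..<q}. expanding_at h u}"
      using neg by (rule negligible_subset) (use that in auto)
  qed fact
  have "f x = f 0" if "x \<in> {0..1}" for x
    using h_eq[of "U 0" "U x"] that U_in[of x] U_0 hU[of x] hU[of 0] by auto
  then have "f constant_on {0..1}" unfolding constant_on_def by blast
  with f(2) show False by simp
qed

lemma critical_holder_exponent_eq: "ereal (critical_holder_exponent \<Lambda>) = upper_hausdorff_dim \<Lambda>"
proof -
  define A where "A = {\<alpha>. 0 < \<alpha> \<and> \<alpha> \<le> 1 \<and>
      (\<exists>f\<in>dirichlet_domain \<Lambda>. \<not> f constant_on {0..1} \<and> holder_on \<alpha> {0..1} f)}"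
  define \<delta> where "\<delta> = critical_holder_exponent \<Lambda>"
  have \<delta>: "\<delta> = (if A = {} then 0 else Sup A)"
    by (simp only: \<delta>_def critical_holder_exponent_def A_def Let_def)
  have "bdd_above A" by (rule bdd_aboveI[of _ 1]) (simp add: A_def)
  then have A_le: "\<alpha> \<le> \<delta>" if "\<alpha> \<in> A" for \<alpha>
    using that by (auto simp: \<delta> intro: cSup_upper)
  \<comment> \<open>This covers the empty supremum too: its default value is zero, and the dimension is never negative.\<close>
  have "0 \<le> \<delta>"
  proof (cases "A = {}")
    case False
    then obtain \<alpha> where "\<alpha> \<in> A" by auto
    then show ?thesis using A_le[of \<alpha>] by (simp add: A_def)
  qed (simp add: \<delta>)
  have "ereal \<delta> \<le> upper_hausdorff_dim \<Lambda>"
  proof (rule ccontr)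
    assume "\<not> ?thesis"
    then obtain b where b: "upper_hausdorff_dim \<Lambda> < ereal b" "b < \<delta>"
      using ereal_dense2[of "upper_hausdorff_dim \<Lambda>" "ereal \<delta>"] by (auto simp: not_le)
    have "A \<noteq> {}"
    proof
      assume "A = {}"
      then have "ereal b < 0" using b(2) by (simp add: \<delta>)
      with b(1) have "upper_hausdorff_dim \<Lambda> < 0" by (rule less_trans)
      with leD[OF upper_hausdorff_dim_nonneg] show False by contradiction
    qed
    moreover have "\<alpha> \<le> b" if "\<alpha> \<in> A" for \<alpha>
    proof -
      have "ereal \<alpha> \<le> upper_hausdorff_dim \<Lambda>"
        using that holder_exponent_le_upper_hausdorff_dim by (auto simp: A_def)
      then have "ereal \<alpha> < ereal b" using b(1) by (rule le_less_trans)
      then show ?thesis by simp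
    qed
    ultimately have "\<delta> \<le> b" by (simp add: \<delta> cSup_least)
    with b(2) show False by simp
  qed
  moreover have "upper_hausdorff_dim \<Lambda> \<le> ereal \<delta>"
  proof (rule ccontr)
    assume "\<not> ?thesis"
    then obtain \<alpha> where \<alpha>: "\<delta> < \<alpha>" "ereal \<alpha> < upper_hausdorff_dim \<Lambda>"
      using ereal_dense2[of "ereal \<delta>" "upper_hausdorff_dim \<Lambda>"] by (auto simp: not_le)
    then have "0 < \<alpha>" using \<open>0 \<le> \<delta>\<close> by simp
    then obtain f where f: "f \<in> dirichlet_domain \<Lambda>" "\<not> f constant_on {0..1}" "holder_on \<alpha> {0..1} f"
      using \<alpha>(2) by (rule ex_holder_below_upper_hausdorff_dim)
    have "\<alpha> \<le> 1"
      using f holder_on_exponent_gt_1_imp_constant_on[of \<alpha> "{0..1}" f] by force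
    then have "\<alpha> \<in> A" using f \<open>0 < \<alpha>\<close> by (auto simp: A_def)
    with A_le \<alpha>(1) show False by force
  qed
  ultimately show ?thesis by (simp add: \<delta>_def)
qed

end

theorem corollary1p5:
  fixes \<Lambda> :: "real measure"
  assumes "radon_prob_unit_interval \<Lambda>"
    and "non_atomic \<Lambda>"
    and "full_support \<Lambda>"
  shows "ereal (critical_holder_exponent \<Lambda>) = upper_hausdorff_dim \<Lambda>"
proof -
  interpret prob_space \<Lambda> using assms(1) by (simp add: radon_prob_unit_interval_def)
  interpret full_nonatomic_measure \<Lambda>
    using assms by unfold_locales (simp_all add: radon_prob_unit_interval_def)
  show ?thesis by (rule critical_holder_exponent_eq)
qed

end
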